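(* Let $n\ge 3$, let $K$ be a field, $S=K[x_1,\ldots,x_n]$ and $J_n=(x_1x_2,x_2x_3,\ldots,x_{n-1}x_n,x_nx_1)\subset S$. Then: (1) $\operatorname{hdepth}(S/J_n)$ is the maximum of all integers $d$ with $0\le d\le n$ such that $\sum_{j=0}^k(-1)^{k-j}\binom{d-j}{k-j}\left(\binom{n-j}{j}+\binom{n-j-1}{j-1}\right)\ge 0$ for all $1\le k\le d$. (2) $\operatorname{hdepth}(J_n)$ is the maximum of all integers $d$ with $0\le d\le n$ such that $\sum_{j=0}^k(-1)^{k-j}\binom{d-j}{k-j}\left(\binom{n-j}{j}+\binom{n-j-1}{j-1}\right)\le\binom{n-d+k-1}{k}$ for all $2\le k\le d$.
   Context: $S$ has the standard grading. For a nonzero finitely generated graded $S$-module $M$ with Hilbert series $H_M(t)=\sum_i \dim_K(M_i)t^i$, the Hilbert depth is $\operatorname{hdepth}(M)=\max\{r\ge 0 : (1-t)^rH_M(t)\text{ has only nonnegative coefficients}\}$ (equivalently, the maximal depth of a finitely generated graded $S$-module with the same Hilbert series as $M$). Binomial coefficients: $\binom{a}{0}=1$ for every integer $a$, and $\binom{a}{b}=0$ if $b<0$, or if $b>0$ and $a<b$ (including negative $a$). *)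

theory Defs
  imports
    "HOL-Library.Poly_Mapping"
    "HOL-Algebra.QuotRing"
    "HOL-Computational_Algebra.Formal_Power_Series"
    "Jordan_Normal_Form.VS_Connect"
begin

text \<open>
  A polynomial over \<open>'k\<close> in the variables \<open>x\<^sub>0, x\<^sub>1, \<dots>\<close> is a finitely supported map from exponent
  vectors to coefficients; \<open>K[x\<^sub>1, \<dots>, x\<^sub>n]\<close> is the subring of those that only
  involve \<open>x\<^sub>1, \<dots>, x\<^sub>n\<close>.
\<close>

type_synonym 'k mpol = "(nat \<Rightarrow>\<^sub>0 nat) \<Rightarrow>\<^sub>0 'k"

definition poly_ring :: "nat \<Rightarrow> 'k::field mpol ring" where
  "poly_ring n = \<lparr>carrier = {p. \<forall>m\<in>Poly_Mapping.keys p. Poly_Mapping.keys m \<subseteq> {1..n}},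
     monoid.mult = (*), one = 1, zero = 0, add = (+)\<rparr>"

definition const_pol :: "'k::field \<Rightarrow> 'k mpol" where
  "const_pol c = Poly_Mapping.single 0 c"

definition var_pol :: "nat \<Rightarrow> 'k::field mpol" where
  "var_pol i = Poly_Mapping.single (Poly_Mapping.single i 1) 1"

definition mon_deg :: "(nat \<Rightarrow>\<^sub>0 nat) \<Rightarrow> nat" where
  "mon_deg m = (\<Sum>i\<in>Poly_Mapping.keys m. Poly_Mapping.lookup m i)"

definition homog_part :: "nat \<Rightarrow> nat \<Rightarrow> 'k::field mpol set" where
  "homog_part n i = {p \<in> carrier (poly_ring n). \<forall>m\<in>Poly_Mapping.keys p. mon_deg m = i}"


text \<open>
  A graded module over \<^term>\<open>poly_ring n\<close> is given by a module record \<open>M\<close> together with the family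
  \<open>G\<close> of its homogeneous components, \<open>G i\<close> being the component of degree \<open>i\<close>. All
  modules considered here live in nonnegative degrees, so their Hilbert series are
  ordinary formal power series. The scalars from \<open>K\<close> act through the constant polynomials; the
  ring fields \<open>mult\<close> and \<open>one\<close> of a module record play no role.
\<close>

definition component_space ::
  "('k::field mpol, 'm) module \<Rightarrow> (nat \<Rightarrow> 'm set) \<Rightarrow> nat \<Rightarrow> ('k, 'm) module" where
  "component_space M G i = \<lparr>carrier = G i, monoid.mult = undefined, one = undefined,
     zero = \<zero>\<^bsub>M\<^esub>, add = add M, smult = (\<lambda>c v. const_pol c \<odot>\<^bsub>M\<^esub> v)\<rparr>"

definition hilbert_series :: "('k::field mpol, 'm) module \<Rightarrow> (nat \<Rightarrow> 'm set) \<Rightarrow> int fps" where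
  "hilbert_series M G = Abs_fps (\<lambda>i. int (vectorspace.dim class_ring (component_space M G i)))"

definition hdepth :: "('k::field mpol, 'm) module \<Rightarrow> (nat \<Rightarrow> 'm set) \<Rightarrow> nat" where
  "hdepth M G = Max {r. \<forall>i. 0 \<le> fps_nth ((1 - fps_X) ^ r * hilbert_series M G) i}"


definition ideal_module :: "'k::field mpol set \<Rightarrow> ('k mpol, 'k mpol) module" where
  "ideal_module I = \<lparr>carrier = I, monoid.mult = undefined, one = undefined,
     zero = 0, add = (+), smult = (*)\<rparr>"

definition ideal_part :: "nat \<Rightarrow> 'k::field mpol set \<Rightarrow> nat \<Rightarrow> 'k mpol set" where
  "ideal_part n I i = I \<inter> homog_part n i"

definition quot_module :: "nat \<Rightarrow> 'k::field mpol set \<Rightarrow> ('k mpol, 'k mpol set) module" where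
  "quot_module n I = (let Q = poly_ring n Quot I in
     \<lparr>carrier = carrier Q, monoid.mult = undefined, one = undefined, zero = \<zero>\<^bsub>Q\<^esub>, add = add Q,
      smult = (\<lambda>s v. (I +>\<^bsub>poly_ring n\<^esub> s) \<otimes>\<^bsub>Q\<^esub> v)\<rparr>)"

definition quot_part :: "nat \<Rightarrow> 'k::field mpol set \<Rightarrow> nat \<Rightarrow> 'k mpol set set" where
  "quot_part n I i = (\<lambda>p. I +>\<^bsub>poly_ring n\<^esub> p) ` homog_part n i"


definition cycle_ideal :: "nat \<Rightarrow> 'k::field mpol set" where
  "cycle_ideal n = Idl\<^bsub>poly_ring n\<^esub>
     ({var_pol i * var_pol (i + 1) | i. 1 \<le> i \<and> i < n} \<union> {var_pol n * var_pol 1})"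


text \<open>
  The convention for binomial coefficients with integer entries: the value is \<open>1\<close> if \<open>b = 0\<close>
  (whatever \<open>a\<close> is) and \<open>0\<close> if \<open>a < b\<close> with \<open>b > 0\<close>, so this is not \<open>gbinomial\<close>
  for negative \<open>a\<close>.
\<close>

definition ibinom :: "int \<Rightarrow> int \<Rightarrow> int" where
  "ibinom a b = (if b = 0 then 1 else if b < 0 \<or> a < b then 0 else int (nat a choose nat b))"


text \<open>The modules and the component spaces are genuine ones, so that the dimensions make sense.\<close>

lemma poly_ring_ops:
  "p \<otimes>\<^bsub>poly_ring n\<^esub> q = p * q" "p \<oplus>\<^bsub>poly_ring n\<^esub> q = p + q"
  "\<zero>\<^bsub>poly_ring n\<^esub> = 0" "\<one>\<^bsub>poly_ring n\<^esub> = 1"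
  by (simp_all add: poly_ring_def)

lemma carrier_poly_ring_0_1: "0 \<in> carrier (poly_ring n)" "1 \<in> carrier (poly_ring n)"
  by (auto simp: poly_ring_def simp flip: single_one)

lemma carrier_poly_ring_mult:
  assumes "p \<in> carrier (poly_ring n)" "q \<in> carrier (poly_ring n)"
  shows "p * q \<in> carrier (poly_ring n)"
proof -
  have "Poly_Mapping.keys m \<subseteq> {1..n}" if "m \<in> Poly_Mapping.keys (p * q)" for m
  proof -
    from that keys_mult[of p q] obtain a b where m: "m = a + b"
      "a \<in> Poly_Mapping.keys p" "b \<in> Poly_Mapping.keys q" by blast
    then show ?thesis
      using assms Poly_Mapping.keys_add[of a b] by (fastforce simp: poly_ring_def)
  qed
  then show ?thesis by (simp add: poly_ring_def)
qed

lemma carrier_poly_ring_add: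
  assumes "p \<in> carrier (poly_ring n)" "q \<in> carrier (poly_ring n)"
  shows "p + q \<in> carrier (poly_ring n)"
  using assms Poly_Mapping.keys_add[of p q] by (fastforce simp: poly_ring_def)

lemma carrier_poly_ring_uminus:
  assumes "p \<in> carrier (poly_ring n)"
  shows "- p \<in> carrier (poly_ring n)"
  using assms by (simp add: poly_ring_def)

lemma cring_poly_ring: "cring (poly_ring n :: 'k::field mpol ring)"
proof (rule cringI)
  show "abelian_group (poly_ring n :: 'k mpol ring)"
  proof (rule abelian_groupI)
    fix x :: "'k mpol" assume x: "x \<in> carrier (poly_ring n)"
    show "\<exists>y\<in>carrier (poly_ring n). y \<oplus>\<^bsub>poly_ring n\<^esub> x = \<zero>\<^bsub>poly_ring n\<^esub>"
      by (rule bexI[OF _ carrier_poly_ring_uminus[OF x]]) (simp add: poly_ring_ops)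
  qed (use carrier_poly_ring_add in \<open>auto simp: poly_ring_ops carrier_poly_ring_0_1 add_ac\<close>)
  show "comm_monoid (poly_ring n :: 'k mpol ring)"
    by (rule comm_monoidI)
      (use carrier_poly_ring_mult[of _ n] in \<open>auto simp: poly_ring_ops carrier_poly_ring_0_1 mult_ac\<close>)
qed (simp add: poly_ring_ops distrib_right)

lemma const_pol_in_carrier: "const_pol c \<in> carrier (poly_ring n)"
  by (simp add: const_pol_def poly_ring_def)

lemma var_pol_in_carrier: "i \<in> {1..n} \<Longrightarrow> var_pol i \<in> carrier (poly_ring n)"
  by (simp add: var_pol_def poly_ring_def)

lemma ideal_cycle_ideal:
  assumes "n \<ge> 3"
  shows "ideal (cycle_ideal n :: 'k::field mpol set) (poly_ring n)"
proof -
  interpret cring "poly_ring n :: 'k mpol ring" by (rule cring_poly_ring)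
  show ?thesis unfolding cycle_ideal_def
    by (rule genideal_ideal) (use assms in \<open>auto intro!: carrier_poly_ring_mult var_pol_in_carrier\<close>)
qed

lemma field_class_ring: "Ring.field (class_ring :: 'k::field ring)"
  by (rule class_field.field_axioms)

lemma homog_part_zero: "0 \<in> homog_part n i"
  by (simp add: homog_part_def poly_ring_def)

lemma homog_part_add: "p \<in> homog_part n i \<Longrightarrow> q \<in> homog_part n i \<Longrightarrow> p + q \<in> homog_part n i"
  using Poly_Mapping.keys_add[of p q] carrier_poly_ring_add[of p n q]
  by (auto simp: homog_part_def)

lemma homog_part_uminus: "p \<in> homog_part n i \<Longrightarrow> - p \<in> homog_part n i"
  using carrier_poly_ring_uminus[of p n] by (simp add: homog_part_def)

lemma homog_part_smult: "p \<in> homog_part n i \<Longrightarrow> const_pol c * p \<in> homog_part n i"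
  using keys_mult[of "const_pol c" p] carrier_poly_ring_mult[OF const_pol_in_carrier[of c n], of p]
  by (auto simp: homog_part_def const_pol_def split: if_splits)

lemma module_ideal_module:
  assumes "ideal I (poly_ring n :: 'k::field mpol ring)"
  shows "Module.module (poly_ring n) (ideal_module I)"
proof -
  interpret S: cring "poly_ring n :: 'k mpol ring" by (rule cring_poly_ring)
  interpret I: ideal I "poly_ring n :: 'k mpol ring" by fact
  have neg: "- x \<in> I" if "x \<in> I" for x
  proof -
    have "- x = (- 1) * x" by simp
    moreover have "(- 1) \<otimes>\<^bsub>poly_ring n\<^esub> x \<in> I"
      by (rule I.I_l_closed[OF that]) (intro carrier_poly_ring_uminus carrier_poly_ring_0_1)
    ultimately show ?thesis by (simp add: poly_ring_ops)
  qed
  have abel: "abelian_group (ideal_module I)"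
  proof (rule abelian_groupI)
    fix x assume "x \<in> carrier (ideal_module I)"
    then show "\<exists>y\<in>carrier (ideal_module I). y \<oplus>\<^bsub>ideal_module I\<^esub> x = \<zero>\<^bsub>ideal_module I\<^esub>"
      by (intro bexI[of _ "- x"]) (simp_all add: ideal_module_def neg)
  qed (use additive_subgroup.a_closed[OF ideal.axioms(1)[OF assms], unfolded poly_ring_ops] additive_subgroup.zero_closed[OF ideal.axioms(1)[OF assms], unfolded poly_ring_ops] in \<open>auto simp: poly_ring_ops ideal_module_def add_ac\<close>)
  show ?thesis
    by (rule Module.moduleI[OF S.is_cring abel])
      (use I.I_l_closed[unfolded poly_ring_ops] in \<open>auto simp: poly_ring_ops ideal_module_def distrib_left distrib_right mult.assoc\<close>)
qed

lemma module_quot_module: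
  assumes "ideal I (poly_ring n :: 'k::field mpol ring)"
  shows "Module.module (poly_ring n) (quot_module n I)"
proof -
  interpret S: cring "poly_ring n :: 'k mpol ring" by (rule cring_poly_ring)
  interpret I: ideal I "poly_ring n :: 'k mpol ring" by fact
  interpret Q: cring "poly_ring n Quot I" by (rule I.quotient_is_cring[OF S.is_cring])
  interpret h: ring_hom_ring "poly_ring n" "poly_ring n Quot I" "(+>\<^bsub>poly_ring n\<^esub>) I"
    by (rule I.rcos_ring_hom_ring)
  have abel: "abelian_group (quot_module n I)"
    by (rule abelian_groupI)
      (auto simp: quot_module_def Let_def Q.a_ac intro: Q.add.l_inv_ex)
  show ?thesis
    by (rule Module.moduleI[OF S.is_cring abel])
      (auto simp: quot_module_def Let_def Q.l_distr Q.r_distr Q.m_assoc)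
qed

lemma vectorspace_component_space:
  fixes M :: "('k::field mpol, 'm) module"
  assumes M: "Module.module (poly_ring n) M"
    and sub: "G i \<subseteq> carrier M" and zero: "\<zero>\<^bsub>M\<^esub> \<in> G i"
    and add: "\<And>u v. u \<in> G i \<Longrightarrow> v \<in> G i \<Longrightarrow> u \<oplus>\<^bsub>M\<^esub> v \<in> G i"
    and smult: "\<And>c v. v \<in> G i \<Longrightarrow> const_pol c \<odot>\<^bsub>M\<^esub> v \<in> G i"
  shows "vectorspace class_ring (component_space M G i)"
proof -
  interpret M: Module.module "poly_ring n" M by fact
  have inC: "u \<in> carrier M" if "u \<in> G i" for u using sub that by blast
  have cc: "const_pol c \<in> carrier (poly_ring n)" for c :: 'k by (rule const_pol_in_carrier)
  have one: "const_pol 1 = \<one>\<^bsub>poly_ring n :: 'k mpol ring\<^esub>"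
    by (simp add: const_pol_def poly_ring_ops)
  have cadd: "const_pol (a + b) = const_pol a \<oplus>\<^bsub>poly_ring n\<^esub> const_pol b" for a b :: 'k
    by (simp add: const_pol_def poly_ring_ops single_add)
  have cmul: "const_pol (a * b) = const_pol a \<otimes>\<^bsub>poly_ring n\<^esub> const_pol b" for a b :: 'k
    by (simp add: const_pol_def poly_ring_ops mult_single)
  have neg: "\<exists>v\<in>G i. v \<oplus>\<^bsub>M\<^esub> u = \<zero>\<^bsub>M\<^esub>" if u: "u \<in> G i" for u
  proof (rule bexI[OF _ smult[OF u, of "- 1"]])
    have "const_pol (- 1) \<odot>\<^bsub>M\<^esub> u \<oplus>\<^bsub>M\<^esub> const_pol 1 \<odot>\<^bsub>M\<^esub> u = const_pol 0 \<odot>\<^bsub>M\<^esub> u"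
      using M.smult_l_distr[OF cc cc inC[OF u]] cadd[of "- 1" 1] by simp
    moreover have "const_pol 0 = \<zero>\<^bsub>poly_ring n :: 'k mpol ring\<^esub>"
      by (simp add: const_pol_def poly_ring_ops)
    ultimately show "const_pol (- 1) \<odot>\<^bsub>M\<^esub> u \<oplus>\<^bsub>M\<^esub> u = \<zero>\<^bsub>M\<^esub>"
      using inC[OF u] by (simp add: one)
  qed
  have abel: "abelian_group (component_space M G i)"
    by (rule abelian_groupI)
      (use zero neg add inC in \<open>auto simp: component_space_def M.a_ac\<close>)
  have "Module.module class_ring (component_space M G i)"
    by (rule Module.moduleI[OF _ abel])
      (use inC smult cc in \<open>auto simp: component_space_def cadd cmul one M.smult_l_distr
         M.smult_r_distr M.smult_assoc1 intro: domain.axioms(1) field.axioms(1) field_class_ring\<close>)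
  then show ?thesis
    by (intro vectorspace.intro field_class_ring)
qed

lemma vectorspace_ideal_part:
  assumes "ideal I (poly_ring n :: 'k::field mpol ring)"
  shows "vectorspace class_ring (component_space (ideal_module I) (ideal_part n I) i)"
proof -
  interpret I: ideal I "poly_ring n :: 'k mpol ring" by fact
  show ?thesis
    by (rule vectorspace_component_space[OF module_ideal_module[OF assms]])
      (use additive_subgroup.zero_closed[OF ideal.axioms(1)[OF assms], unfolded poly_ring_ops] additive_subgroup.a_closed[OF ideal.axioms(1)[OF assms], unfolded poly_ring_ops]
          I.I_l_closed[OF _ const_pol_in_carrier, unfolded poly_ring_ops] in
        \<open>auto simp: ideal_part_def ideal_module_def poly_ring_ops
           intro: homog_part_zero homog_part_add homog_part_smult\<close>)
qed

lemma vectorspace_quot_part: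
  assumes "ideal I (poly_ring n :: 'k::field mpol ring)"
  shows "vectorspace class_ring (component_space (quot_module n I) (quot_part n I) i)"
proof -
  interpret S: cring "poly_ring n :: 'k mpol ring" by (rule cring_poly_ring)
  interpret I: ideal I "poly_ring n :: 'k mpol ring" by fact
  interpret h: ring_hom_ring "poly_ring n" "poly_ring n Quot I" "(+>\<^bsub>poly_ring n\<^esub>) I"
    by (rule I.rcos_ring_hom_ring)
  have C: "p \<in> carrier (poly_ring n)" if "p \<in> homog_part n i" for p :: "'k mpol"
    using that by (simp add: homog_part_def)
  show ?thesis
  proof (rule vectorspace_component_space[OF module_quot_module[OF assms]])
    show "quot_part n I i \<subseteq> carrier (quot_module n I)"
      using C h.hom_closed by (auto simp: quot_part_def quot_module_def Let_def)
    have "I +>\<^bsub>poly_ring n\<^esub> 0 = \<zero>\<^bsub>poly_ring n Quot I\<^esub>"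
      using h.hom_zero by (simp add: poly_ring_ops)
    then show "\<zero>\<^bsub>quot_module n I\<^esub> \<in> quot_part n I i"
      using homog_part_zero[of n i] by (force simp: quot_part_def quot_module_def Let_def)
  next
    fix u v assume "u \<in> quot_part n I i" "v \<in> quot_part n I i"
    then obtain p q where pq: "p \<in> homog_part n i" "q \<in> homog_part n i"
      "u = I +>\<^bsub>poly_ring n\<^esub> p" "v = I +>\<^bsub>poly_ring n\<^esub> q" by (auto simp: quot_part_def)
    then have "u \<oplus>\<^bsub>quot_module n I\<^esub> v = I +>\<^bsub>poly_ring n\<^esub> (p \<oplus>\<^bsub>poly_ring n\<^esub> q)"
      using C by (simp add: quot_module_def Let_def)
    also have "p \<oplus>\<^bsub>poly_ring n\<^esub> q = p + q" by (simp add: poly_ring_ops)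
    finally show "u \<oplus>\<^bsub>quot_module n I\<^esub> v \<in> quot_part n I i"
      using homog_part_add[OF pq(1,2)] by (simp add: quot_part_def)
  next
    fix c v assume "v \<in> quot_part n I i"
    then obtain p where p: "p \<in> homog_part n i" "v = I +>\<^bsub>poly_ring n\<^esub> p"
      by (auto simp: quot_part_def)
    then have "const_pol c \<odot>\<^bsub>quot_module n I\<^esub> v = I +>\<^bsub>poly_ring n\<^esub> (const_pol c \<otimes>\<^bsub>poly_ring n\<^esub> p)"
      using C const_pol_in_carrier[of c n] by (simp add: quot_module_def Let_def)
    also have "const_pol c \<otimes>\<^bsub>poly_ring n\<^esub> p = const_pol c * p" by (simp add: poly_ring_ops)
    finally show "const_pol c \<odot>\<^bsub>quot_module n I\<^esub> v \<in> quot_part n I i"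
      using homog_part_smult[OF p(1)] by (simp add: quot_part_def)
  qed
qed

end

theory Submission
  imports Defs
begin

text \<open>
  Both modules have a basis of monomials: \<open>J\<^sub>n\<close> is spanned by the monomials whose support contains
  two cyclically adjacent variables, and \<open>S/J\<^sub>n\<close> by the classes of all other monomials. The
  monomials with a fixed support of \<open>j\<close> variables have the generating function \<open>(t/(1-t))\<^sup>j\<close>,
  so each of the two Hilbert series is \<open>\<Sum>\<^sub>j f\<^sub>j (t/(1-t))\<^sup>j\<close>, where \<open>f\<^sub>j\<close> is the number of
  \<open>j\<close>-subsets of the \<open>n\<close>-cycle that are independent (for \<open>S/J\<^sub>n\<close>) or not independent (for \<open>J\<^sub>n\<close>).

  For any such series with \<open>f\<^sub>j \<ge> 0\<close> that is not zero, the exponents \<open>r\<close> for which \<open>(1-t)\<^sup>r\<close> times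
  the series is nonnegative are determined by finitely many inequalities (lemma
  \<open>nonneg_exponents\<close>). The summand \<open>f\<^sub>j t\<^sup>j (1-t)\<^bsup>r-j\<^esup>\<close> is a polynomial of degree \<open>r\<close> if
  \<open>j \<le> r\<close>, and it has nonnegative coefficients if \<open>j > r\<close>. Hence a negative coefficient can only
  occur in degrees \<open>k \<le> r\<close>, where the coefficient is the alternating sum of the theorem. If \<open>r\<close>
  exceeds \<open>n\<close>, the product is a polynomial that vanishes at \<open>t = 1\<close>, and such a polynomial cannot be
  nonzero with nonnegative coefficients; therefore \<open>r \<le> n\<close>.

  It remains to compute the numbers \<open>f\<^sub>j\<close>. An independent \<open>j\<close>-subset of the cycle avoids the vertex
  \<open>n\<close> and lies on the path \<open>1, \<dots>, n-1\<close>, or it contains \<open>n\<close> and otherwise lies on the path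
  \<open>2, \<dots>, n-2\<close>. Paths have binomial counts (lemma \<open>card_path_sets\<close>), and the two cases give the
  two binomial coefficients of the theorem. The dependent sets are the remaining ones of the
  \<open>n choose j\<close> subsets, and the alternating sum of the numbers \<open>n choose j\<close> is a coefficient of
  \<open>(1-t)\<^sup>d / (1-t)\<^sup>n\<close>; this is the right-hand side in the second part. There the inequalities for
  \<open>k \<le> 1\<close> are trivial, as a dependent set has at least two elements.
\<close>

section \<open>Nonnegativity of power series in t/(1-t)\<close>

definition geometric_series :: "int fps" where
  "geometric_series = Abs_fps (\<lambda>_. 1)"

lemma one_minus_X_times_geometric: "(1 - fps_X) * geometric_series = 1"
  by (rule fps_ext) (simp add: geometric_series_def algebra_simps)

text \<open>
  A formula for \<open>(1-t)\<^bsup>r-j\<^esup>\<close> with an integer exponent of either sign, which avoids inverses in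
  the ring of integer power series.
\<close>

lemma one_minus_X_power_times_geometric_power:
  "(1 - fps_X) ^ r * geometric_series ^ j =
     (if j \<le> r then (1 - fps_X) ^ (r - j) else geometric_series ^ (j - r))"
proof (cases "j \<le> r")
  case True
  then have "(1 - fps_X :: int fps) ^ r = (1 - fps_X) ^ (r - j) * (1 - fps_X) ^ j"
    by (simp flip: power_add)
  then show ?thesis
    using True by (simp add: mult.assoc one_minus_X_times_geometric flip: power_mult_distrib)
next
  case False
  then have "geometric_series ^ j = geometric_series ^ r * geometric_series ^ (j - r)"
    by (simp flip: power_add)
  then show ?thesis
    using False by (simp add: mult.assoc[symmetric] one_minus_X_times_geometric flip: power_mult_distrib)
qed

lemma nth_one_minus_X_power:
  "fps_nth ((1 - fps_X :: int fps) ^ m) i = (- 1) ^ i * int (m choose i)"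
proof (induction m arbitrary: i)
  case 0
  then show ?case by (cases i) auto
next
  case (Suc m)
  then show ?case
    by (cases i) (auto simp: left_diff_distrib algebra_simps)
qed

lemma nth_geometric_power_Suc:
  "fps_nth (geometric_series ^ Suc m) k = int ((m + k) choose k)"
proof (induction m arbitrary: k)
  case 0
  then show ?case by (simp add: geometric_series_def)
next
  case (Suc m)
  have "fps_nth (geometric_series ^ Suc (Suc m)) k =
      fps_nth (geometric_series ^ Suc m * geometric_series) k"
    by (simp add: mult_ac)
  also have "\<dots> = (\<Sum>i\<le>k. int ((m + i) choose i))"
    by (simp only: fps_mult_nth Suc) (simp add: geometric_series_def atMost_atLeast0)
  also have "\<dots> = int (Suc (m + k) choose k)"
    by (simp flip: sum_choose_lower)
  finally show ?case by simp
qed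

lemma nth_geometric_power: "fps_nth (geometric_series ^ m) k = ibinom (int m + int k - 1) (int k)"
proof (cases m)
  case 0
  then show ?thesis by (simp add: ibinom_def)
next
  case (Suc l)
  have "nat (int l + int k) = l + k" by simp
  then show ?thesis unfolding Suc by (subst nth_geometric_power_Suc) (simp add: ibinom_def)
qed

text \<open>
  If \<open>f j\<close> is the number of faces with \<open>j\<close> vertices of a simplicial complex with \<open>n\<close> vertices,
  this is the Hilbert series of its Stanley--Reisner ring; if \<open>f j\<close> counts the nonfaces instead, it is
  that of the Stanley--Reisner ideal.
\<close>

definition face_series :: "nat \<Rightarrow> (nat \<Rightarrow> int) \<Rightarrow> int fps" where
  "face_series n f = (\<Sum>j\<le>n. fps_const (f j) * (fps_X * geometric_series) ^ j)"

lemma nth_one_minus_X_power_times_term: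
  "fps_nth ((1 - fps_X) ^ r * (fps_X * geometric_series) ^ j) k =
     (if k < j then 0
      else if j \<le> r then (- 1) ^ (k - j) * int ((r - j) choose (k - j))
      else fps_nth (geometric_series ^ (j - r)) (k - j))"
proof -
  have "(1 - fps_X) ^ r * (fps_X * geometric_series) ^ j =
      fps_X ^ j * ((1 - fps_X) ^ r * geometric_series ^ j)"
    by (simp add: power_mult_distrib mult_ac)
  then show ?thesis
    by (simp add: fps_X_power_mult_nth one_minus_X_power_times_geometric_power nth_one_minus_X_power)
qed

lemma nth_one_minus_X_power_times_face_series:
  "fps_nth ((1 - fps_X) ^ r * face_series n f) k =
     (\<Sum>j\<le>n. f j * fps_nth ((1 - fps_X) ^ r * (fps_X * geometric_series) ^ j) k)"
proof -
  have "(1 - fps_X) ^ r * face_series n f =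
      (\<Sum>j\<le>n. fps_const (f j) * ((1 - fps_X) ^ r * (fps_X * geometric_series) ^ j))"
    by (simp add: face_series_def sum_distrib_left mult_ac)
  then show ?thesis by (simp add: fps_sum_nth)
qed

lemma nth_face_series_low:
  assumes "k \<le> r" "k \<le> n"
  shows "fps_nth ((1 - fps_X) ^ r * face_series n f) k =
     (\<Sum>j\<le>k. (- 1) ^ (k - j) * int ((r - j) choose (k - j)) * f j)"
proof -
  have "fps_nth ((1 - fps_X) ^ r * face_series n f) k =
      (\<Sum>j\<le>k. f j * fps_nth ((1 - fps_X) ^ r * (fps_X * geometric_series) ^ j) k)"
    unfolding nth_one_minus_X_power_times_face_series using assms
    by (intro sum.mono_neutral_right) (auto simp: nth_one_minus_X_power_times_term)
  also have "\<dots> = (\<Sum>j\<le>k. (- 1) ^ (k - j) * int ((r - j) choose (k - j)) * f j)"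
    using assms by (intro sum.cong) (auto simp: nth_one_minus_X_power_times_term)
  finally show ?thesis .
qed

text \<open>
  Above degree \<open>r\<close> the terms with \<open>j \<le> r\<close> have died out, as they are polynomials of degree \<open>r\<close>;
  the other terms are multiples of powers of the geometric series.
\<close>

lemma nth_face_series_high:
  assumes "r < k" "\<And>j. 0 \<le> f j"
  shows "0 \<le> fps_nth ((1 - fps_X) ^ r * face_series n f) k"
  unfolding nth_one_minus_X_power_times_face_series
proof (rule sum_nonneg)
  fix j
  have "0 \<le> fps_nth (geometric_series ^ (j - r)) (k - j)"
    unfolding nth_geometric_power ibinom_def by auto
  then have "0 \<le> fps_nth ((1 - fps_X) ^ r * (fps_X * geometric_series) ^ j) k"
    using assms(1) by (auto simp: nth_one_minus_X_power_times_term binomial_eq_0)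
  then show "0 \<le> f j * fps_nth ((1 - fps_X) ^ r * (fps_X * geometric_series) ^ j) k"
    using assms(2) by simp
qed

text \<open>
  For \<open>r > n\<close> every term \<open>t\<^sup>j (1-t)\<^bsup>r-j\<^esup>\<close> is a polynomial that vanishes at \<open>t = 1\<close>. So the
  coefficients of the product add up to 0, and all of them vanish if they are nonnegative. But the
  lowest coefficient is the first nonzero value of \<open>f\<close>.
\<close>

lemma exponent_le_if_nonneg:
  assumes nonneg: "\<And>i. 0 \<le> fps_nth ((1 - fps_X) ^ r * face_series n f) i"
    and f: "j0 \<le> n" "f j0 \<noteq> 0"
  shows "r \<le> n"
proof (rule ccontr)
  assume "\<not> r \<le> n"
  then obtain s where s: "r = Suc s" "n \<le> s" by (cases r) auto
  define F where "F = (1 - fps_X) ^ r * face_series n f"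
  \<comment> \<open>Multiplication by the geometric series forms partial sums of coefficients.\<close>
  have "F * geometric_series = (1 - fps_X) ^ s * face_series n f * ((1 - fps_X) * geometric_series)"
    by (simp add: F_def s mult_ac)
  then have "F * geometric_series = (1 - fps_X) ^ s * face_series n f"
    by (simp add: one_minus_X_times_geometric)
  moreover have "fps_nth ((1 - fps_X) ^ s * face_series n f) r = 0"
    unfolding nth_one_minus_X_power_times_face_series using s
    by (intro sum.neutral) (auto simp: nth_one_minus_X_power_times_term binomial_eq_0)
  ultimately have "(\<Sum>i=0..r. fps_nth F i) = 0"
    by (metis (no_types, lifting) fps_mult_nth geometric_series_def fps_nth_Abs_fps mult.right_neutral sum.cong)
  then have zero: "fps_nth F i = 0" if "i \<le> r" for i
    using that nonneg by (subst (asm) sum_nonneg_eq_0_iff) (auto simp: F_def)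
  define j where "j = (LEAST j. f j \<noteq> 0)"
  have j: "f j \<noteq> 0" "j \<le> n" "\<And>i. i < j \<Longrightarrow> f i = 0"
    using f(2) LeastI[of "\<lambda>j. f j \<noteq> 0" j0] Least_le[of "\<lambda>j. f j \<noteq> 0" j0] f(1)
    by (auto simp: j_def dest: not_less_Least)
  have "fps_nth F j = (\<Sum>i\<le>j. (- 1) ^ (j - i) * int ((r - i) choose (j - i)) * f i)"
    unfolding F_def using j(2) s by (intro nth_face_series_low) auto
  also have "\<dots> = (\<Sum>i\<in>{j}. (- 1) ^ (j - i) * int ((r - i) choose (j - i)) * f i)"
    by (rule sum.mono_neutral_right) (auto simp: j(3))
  finally show False
    using zero[of j] j s by simp
qed

lemma nonneg_exponents:
  assumes "\<And>j. 0 \<le> f j" and "j0 \<le> n" "f j0 \<noteq> 0"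
  shows "{r. \<forall>i. 0 \<le> fps_nth ((1 - fps_X) ^ r * face_series n f) i} =
     {d. d \<le> n \<and> (\<forall>k\<le>d. 0 \<le> (\<Sum>j\<le>k. (- 1) ^ (k - j) * int ((d - j) choose (k - j)) * f j))}"
    (is "?L = ?R")
proof (intro equalityI subsetI)
  fix r assume r: "r \<in> ?L"
  then have "r \<le> n" using exponent_le_if_nonneg[of r n f j0] assms by simp
  then show "r \<in> ?R" using r by (auto simp flip: nth_face_series_low[of _ r n f])
next
  fix r assume r: "r \<in> ?R"
  have "0 \<le> fps_nth ((1 - fps_X) ^ r * face_series n f) i" for i
    using r nth_face_series_high[of r i f n] assms(1) by (cases "i \<le> r") (auto simp: nth_face_series_low)
  then show "r \<in> ?L" by simp
qed

text \<open>
  The full simplex: the binomial theorem for \<open>(1 + t/(1-t))\<^sup>n = 1/(1-t)\<^sup>n\<close>, the Hilbert series of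
  the polynomial ring.
\<close>

lemma face_series_full: "face_series n (\<lambda>j. int (n choose j)) = geometric_series ^ n"
proof -
  have "geometric_series = fps_X * geometric_series + 1"
    using one_minus_X_times_geometric by (simp add: algebra_simps)
  then have "geometric_series ^ n = (fps_X * geometric_series + 1) ^ n" by simp
  then show ?thesis
    by (simp add: face_series_def binomial_ring fps_of_nat fps_of_int flip: fps_of_nat fps_of_int)
qed

lemma alternating_sum_full:
  assumes "k \<le> d" "d \<le> n"
  shows "(\<Sum>j\<le>k. (- 1) ^ (k - j) * int ((d - j) choose (k - j)) * int (n choose j)) =
     ibinom (int n - int d + int k - 1) (int k)"
proof -
  have "(\<Sum>j\<le>k. (- 1) ^ (k - j) * int ((d - j) choose (k - j)) * int (n choose j)) =
      fps_nth ((1 - fps_X) ^ d * geometric_series ^ n) k"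
    using assms by (simp add: nth_face_series_low flip: face_series_full)
  also have "\<dots> = fps_nth (geometric_series ^ (n - d)) k"
    using assms by (auto simp: one_minus_X_power_times_geometric_power)
  finally show ?thesis using assms by (simp add: nth_geometric_power of_nat_diff)
qed

section \<open>Independent sets of paths and cycles\<close>

definition consecutive_free :: "nat set \<Rightarrow> bool" where
  "consecutive_free B \<longleftrightarrow> (\<forall>i. \<not> (i \<in> B \<and> Suc i \<in> B))"

definition path_sets :: "nat \<Rightarrow> nat \<Rightarrow> nat \<Rightarrow> nat set set" where
  "path_sets a m j = {B. B \<subseteq> {a..<a + m} \<and> consecutive_free B \<and> card B = j}"

lemma finite_path_sets: "finite (path_sets a m j)"
  by (simp add: path_sets_def)

lemma path_sets_0: "path_sets a m 0 = {{}}"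
proof -
  have "B = {}" if "B \<subseteq> {a..<a + m}" "card B = 0" for B
    using that finite_subset[OF that(1)] by simp
  then show ?thesis by (auto simp: path_sets_def consecutive_free_def)
qed

lemma card_insert_image:
  assumes "\<And>B. B \<in> F \<Longrightarrow> x \<notin> B"
  shows "card (insert x ` F) = card F"
proof (rule card_image, rule inj_onI)
  fix B C assume "B \<in> F" "C \<in> F" "insert x B = insert x C"
  then show "B = C" using assms[of B] assms[of C] by (simp add: insert_ident)
qed

text \<open>
  A set on a path either avoids the last vertex, or contains it and then avoids the one before.
\<close>

lemma path_sets_Suc_Suc:
  "path_sets a (Suc (Suc m)) (Suc j) =
     path_sets a (Suc m) (Suc j) \<union> insert (Suc (a + m)) ` path_sets a m j"
proof (intro equalityI subsetI)
  fix B assume B: "B \<in> path_sets a (Suc (Suc m)) (Suc j)"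
  then have sub: "B \<subseteq> {a..<a + Suc (Suc m)}" "consecutive_free B" "card B = Suc j"
    by (auto simp: path_sets_def)
  show "B \<in> path_sets a (Suc m) (Suc j) \<union> insert (Suc (a + m)) ` path_sets a m j"
  proof (cases "Suc (a + m) \<in> B")
    case True
    then have "a + m \<notin> B" using sub(2) by (auto simp: consecutive_free_def)
    have "B - {Suc (a + m)} \<subseteq> {a..<a + m}"
    proof
      fix x assume "x \<in> B - {Suc (a + m)}"
      then have "x \<in> {a..<a + Suc (Suc m)}" "x \<noteq> Suc (a + m)" "x \<noteq> a + m"
        using sub(1) \<open>a + m \<notin> B\<close> by auto
      then show "x \<in> {a..<a + m}" by auto
    qed
    then have "B - {Suc (a + m)} \<in> path_sets a m j"
      using sub True by (auto simp: path_sets_def consecutive_free_def)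
    then show ?thesis using True by (auto intro!: image_eqI[of _ _ "B - {Suc (a + m)}"])
  next
    case False
    have "B \<subseteq> {a..<a + Suc m}"
    proof
      fix x assume "x \<in> B"
      then have "x \<in> {a..<a + Suc (Suc m)}" "x \<noteq> Suc (a + m)" using sub False by auto
      then show "x \<in> {a..<a + Suc m}" by auto
    qed
    then show ?thesis using sub by (auto simp: path_sets_def)
  qed
next
  fix B assume "B \<in> path_sets a (Suc m) (Suc j) \<union> insert (Suc (a + m)) ` path_sets a m j"
  then consider "B \<in> path_sets a (Suc m) (Suc j)"
    | C where "B = insert (Suc (a + m)) C" "C \<in> path_sets a m j" by auto
  then show "B \<in> path_sets a (Suc (Suc m)) (Suc j)"
  proof cases
    case 1
    then show ?thesis by (force simp: path_sets_def)
  next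
    case 2
    then have C: "C \<subseteq> {a..<a + m}" "consecutive_free C" "card C = j" "finite C"
      by (auto simp: path_sets_def intro: finite_subset)
    have "card B = Suc j" using C by (subst 2(1), subst card_insert_disjoint) auto
    then show ?thesis using C 2(1) by (fastforce simp: path_sets_def consecutive_free_def)
  qed
qed

text \<open>
  The recursion for the sets on a path becomes Pascal's rule. The truncated subtraction
  gives the correct value 0 when \<open>j\<close> exceeds \<open>m + 1\<close>, since then \<open>j > 0\<close> and the upper entry is 0.
\<close>

lemma card_path_sets: "card (path_sets a m j) = (Suc m - j) choose j"
proof (induction m arbitrary: j rule: induct_nat_012)
  case 0
  have "path_sets a 0 j = (if j = 0 then {{}} else {})"
    by (auto simp: path_sets_def consecutive_free_def)
  then show ?case by (cases j) auto
next
  case 1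
  have "path_sets a (Suc 0) j = (if j = 0 then {{}} else if j = 1 then {{a}} else {})"
    by (auto simp: path_sets_def consecutive_free_def subset_singleton_iff)
  then show ?case by (cases j) auto
next
  case (ge2 m)
  show ?case
  proof (cases j)
    case 0
    then show ?thesis by (simp add: path_sets_0)
  next
    case (Suc i)
    have notin: "Suc (a + m) \<notin> B" if "B \<in> path_sets a (Suc m) k \<or> B \<in> path_sets a m k" for B k
      using that by (auto simp: path_sets_def)
    have "card (path_sets a (Suc (Suc m)) j) =
        card (path_sets a (Suc m) (Suc i)) + card (insert (Suc (a + m)) ` path_sets a m i)"
      unfolding Suc path_sets_Suc_Suc using notin
      by (intro card_Un_disjoint) (auto simp: finite_path_sets)
    also have "card (insert (Suc (a + m)) ` path_sets a m i) = card (path_sets a m i)"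
      using notin by (intro card_insert_image) auto
    also have "card (path_sets a (Suc m) (Suc i)) + card (path_sets a m i) =
        (Suc m - i choose Suc i) + (Suc m - i choose i)"
      by (simp add: ge2)
    also have "\<dots> = Suc (Suc (Suc m)) - j choose j"
      using Suc by (cases "i \<le> Suc m") (auto simp: Suc_diff_le)
    finally show ?thesis .
  qed
qed

definition contains_cycle_edge :: "nat \<Rightarrow> nat set \<Rightarrow> bool" where
  "contains_cycle_edge n B \<longleftrightarrow> (\<exists>i. 1 \<le> i \<and> i < n \<and> i \<in> B \<and> i + 1 \<in> B) \<or> (n \<in> B \<and> 1 \<in> B)"

text \<open>
  Removing the vertex \<open>m + 3\<close> leaves a path with \<open>m + 2\<close> vertices; removing also its two
  neighbours \<open>1\<close> and \<open>m + 2\<close> leaves the path from \<open>2\<close> to \<open>m + 1\<close>.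
\<close>

lemma cycle_independent_sets_eq:
  "{B. B \<subseteq> {1..m + 3} \<and> \<not> contains_cycle_edge (m + 3) B \<and> card B = Suc j} =
     path_sets 1 (m + 2) (Suc j) \<union> insert (m + 3) ` path_sets 2 m j" (is "?L = _")
proof (intro equalityI subsetI)
  fix B assume "B \<in> ?L"
  then have B: "B \<subseteq> {1..m + 3}" "card B = Suc j" and
    nc: "\<And>i. 1 \<le> i \<Longrightarrow> i < m + 3 \<Longrightarrow> i \<in> B \<Longrightarrow> Suc i \<notin> B" "m + 3 \<in> B \<Longrightarrow> 1 \<notin> B"
    by (auto simp: contains_cycle_edge_def)
  have cf: "consecutive_free B"
    unfolding consecutive_free_def
  proof (intro allI notI)
    fix i assume "i \<in> B \<and> Suc i \<in> B"
    with B have "1 \<le> i" "i < m + 3" "i \<in> B" "Suc i \<in> B" by auto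
    with nc show False by blast
  qed
  show "B \<in> path_sets 1 (m + 2) (Suc j) \<union> insert (m + 3) ` path_sets 2 m j"
  proof (cases "m + 3 \<in> B")
    case True
    then have "m + 2 \<notin> B" "1 \<notin> B" using nc(1)[of "m + 2"] nc(2) by (auto simp: eval_nat_numeral)
    have "B - {m + 3} \<subseteq> {2..<2 + m}"
    proof
      fix x assume "x \<in> B - {m + 3}"
      then have "1 \<le> x" "x \<le> m + 3" "x \<noteq> m + 3" "x \<noteq> m + 2" "x \<noteq> 1"
        using B \<open>m + 2 \<notin> B\<close> \<open>1 \<notin> B\<close> by auto
      then show "x \<in> {2..<2 + m}" by auto
    qed
    then have "B - {m + 3} \<in> path_sets 2 m j"
      using cf B True by (auto simp: path_sets_def consecutive_free_def)
    then show ?thesis using True by (auto intro!: image_eqI[of _ _ "B - {m + 3}"])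
  next
    case False
    have "B \<subseteq> {1..<1 + (m + 2)}"
    proof
      fix x assume "x \<in> B"
      then have "1 \<le> x" "x \<le> m + 3" "x \<noteq> m + 3" using B False by auto
      then show "x \<in> {1..<1 + (m + 2)}" by auto
    qed
    then show ?thesis using B cf by (auto simp: path_sets_def)
  qed
next
  fix B assume "B \<in> path_sets 1 (m + 2) (Suc j) \<union> insert (m + 3) ` path_sets 2 m j"
  then consider "B \<in> path_sets 1 (m + 2) (Suc j)"
    | C where "B = insert (m + 3) C" "C \<in> path_sets 2 m j" by auto
  then show "B \<in> ?L"
  proof cases
    case 1
    then have "B \<subseteq> {1..<m + 3}" "consecutive_free B" "card B = Suc j"
      by (auto simp: path_sets_def)
    then show ?thesis
      by (force simp: contains_cycle_edge_def consecutive_free_def)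
  next
    case 2
    then have C: "C \<subseteq> {2..<m + 2}" "consecutive_free C" "card C = j" "finite C"
      by (auto simp: path_sets_def add.commute intro: finite_subset)
    have "card B = Suc j" using C by (subst 2(1), subst card_insert_disjoint) auto
    then show ?thesis using C 2(1)
      by (fastforce simp: contains_cycle_edge_def consecutive_free_def)
  qed
qed

text \<open>
  The convention for a negative upper entry agrees with truncated subtraction: in both cases
  the value is 1 for \<open>c = 0\<close> and 0 otherwise.
\<close>

lemma ibinom_diff: "ibinom (int p - int q) (int c) = int ((p - q) choose c)"
proof (cases "q \<le> p")
  case True
  have "nat (int p - int q) = p - q" by simp
  then show ?thesis using True by (auto simp: ibinom_def binomial_eq_0 simp del: nat_minus_as_int)
next
  case False
  then show ?thesis by (cases c) (auto simp: ibinom_def)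
qed

lemma no_cycle_edge_if_card_le_1:
  assumes "n \<ge> 2" "finite B" "card B \<le> 1"
  shows "\<not> contains_cycle_edge n B"
proof
  assume "contains_cycle_edge n B"
  then obtain x y where "x \<in> B" "y \<in> B" "x \<noteq> y"
    using assms(1) by (auto simp: contains_cycle_edge_def)
  then have "card {x, y} \<le> card B" using assms(2) by (intro card_mono) auto
  then show False using assms(3) \<open>x \<noteq> y\<close> by simp
qed

lemma card_cycle_independent_sets:
  assumes "n \<ge> 3"
  shows "int (card {B. B \<subseteq> {1..n} \<and> \<not> contains_cycle_edge n B \<and> card B = j}) =
     ibinom (int n - int j) (int j) + ibinom (int n - int j - 1) (int j - 1)"
proof (cases j)
  case 0
  have "{B. B \<subseteq> {1..n} \<and> \<not> contains_cycle_edge n B \<and> card B = 0} = {{}}"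
    by (auto simp: contains_cycle_edge_def dest: finite_subset)
  then show ?thesis using 0 by (simp add: ibinom_def)
next
  case (Suc i)
  obtain m where n: "n = m + 3" using assms by (metis add.commute le_Suc_ex)
  have notin: "m + 3 \<notin> B" if "B \<in> path_sets 1 (m + 2) k \<or> B \<in> path_sets 2 m k" for B k
    using that by (auto simp: path_sets_def)
  have "card {B. B \<subseteq> {1..n} \<and> \<not> contains_cycle_edge n B \<and> card B = j} =
      card (path_sets 1 (m + 2) (Suc i)) + card (insert (m + 3) ` path_sets 2 m i)"
    unfolding n Suc cycle_independent_sets_eq using notin
    by (intro card_Un_disjoint) (auto simp: finite_path_sets)
  also have "card (insert (m + 3) ` path_sets 2 m i) = card (path_sets 2 m i)"
    using notin by (intro card_insert_image) auto
  finally show ?thesis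
    using ibinom_diff[of n j j] ibinom_diff[of n "Suc j" i]
    by (simp add: card_path_sets n Suc algebra_simps)
qed

lemma card_cycle_dependent_sets:
  assumes "n \<ge> 3"
  shows "int (card {B. B \<subseteq> {1..n} \<and> contains_cycle_edge n B \<and> card B = j}) =
     int (n choose j) - (ibinom (int n - int j) (int j) + ibinom (int n - int j - 1) (int j - 1))"
proof -
  have fin: "finite {B. B \<subseteq> {1..n} \<and> Q B}" for Q
    by simp
  have "n choose j = card {B. B \<subseteq> {1..n} \<and> card B = j}"
    using n_subsets[of "{1..n}" j] by simp
  also have "{B. B \<subseteq> {1..n} \<and> card B = j} =
      {B. B \<subseteq> {1..n} \<and> contains_cycle_edge n B \<and> card B = j} \<union>
      {B. B \<subseteq> {1..n} \<and> \<not> contains_cycle_edge n B \<and> card B = j}" by auto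
  also have "card \<dots> = card {B. B \<subseteq> {1..n} \<and> contains_cycle_edge n B \<and> card B = j} +
      card {B. B \<subseteq> {1..n} \<and> \<not> contains_cycle_edge n B \<and> card B = j}"
    by (rule card_Un_disjoint) (use fin in \<open>simp_all add: disjoint_iff\<close>)
  finally show ?thesis
    using card_cycle_independent_sets[OF assms, of j] by linarith
qed

section \<open>Counting monomials by their support\<close>

lemma mon_deg_superset:
  assumes "finite A" "Poly_Mapping.keys m \<subseteq> A"
  shows "mon_deg m = (\<Sum>i\<in>A. Poly_Mapping.lookup m i)"
  unfolding mon_deg_def using assms by (intro sum.mono_neutral_left) (auto simp: in_keys_iff)

lemma mon_deg_add: "mon_deg (m + m') = mon_deg m + mon_deg m'"
proof -
  let ?A = "Poly_Mapping.keys m \<union> Poly_Mapping.keys m'"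
  have "mon_deg (m + m') = (\<Sum>i\<in>?A. Poly_Mapping.lookup (m + m') i)"
    by (rule mon_deg_superset) (use Poly_Mapping.keys_add[of m m'] in auto)
  also have "\<dots> = mon_deg m + mon_deg m'"
    by (simp add: lookup_add sum.distrib mon_deg_superset[of ?A m] mon_deg_superset[of ?A m'])
  finally show ?thesis .
qed

lemma mon_deg_single: "mon_deg (Poly_Mapping.single a l) = l"
  by (simp add: mon_deg_def)

definition monomials_on :: "nat set \<Rightarrow> nat \<Rightarrow> (nat \<Rightarrow>\<^sub>0 nat) set" where
  "monomials_on A i = {m. Poly_Mapping.keys m = A \<and> mon_deg m = i}"

text \<open>
  Splitting off the power of the variable \<open>a\<close>, whose exponent \<open>i - q\<close> is positive.
\<close>

lemma monomials_on_insert: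
  assumes "a \<notin> A"
  shows "monomials_on (insert a A) i =
     (\<Union>q<i. (\<lambda>m. m + Poly_Mapping.single a (i - q)) ` monomials_on A q)" (is "_ = ?R")
proof (intro equalityI subsetI)
  fix m assume m: "m \<in> monomials_on (insert a A) i"
  define l where "l = Poly_Mapping.lookup m a"
  define m' where "m' = m - Poly_Mapping.single a l"
  have l: "l > 0" using m by (auto simp: monomials_on_def l_def in_keys_iff)
  have split: "m = m' + Poly_Mapping.single a l"
  proof (rule poly_mapping_eqI)
    fix x
    show "Poly_Mapping.lookup m x = Poly_Mapping.lookup (m' + Poly_Mapping.single a l) x"
      by (cases "x = a") (simp_all add: m'_def l_def lookup_add lookup_minus lookup_single)
  qed
  have "Poly_Mapping.keys m' = A"
  proof (rule Set.set_eqI)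
    fix x
    have "x \<in> Poly_Mapping.keys m \<longleftrightarrow> x = a \<or> x \<in> A" using m by (auto simp: monomials_on_def)
    then show "x \<in> Poly_Mapping.keys m' \<longleftrightarrow> x \<in> A"
      using assms by (cases "x = a") (auto simp: m'_def l_def in_keys_iff lookup_minus lookup_single when_def)
  qed
  moreover have "i = mon_deg m' + l"
    using m split mon_deg_add[of m' "Poly_Mapping.single a l"]
    by (simp add: monomials_on_def mon_deg_single)
  ultimately have "m' \<in> monomials_on A (mon_deg m')" "mon_deg m' < i" "i - mon_deg m' = l"
    using l by (auto simp: monomials_on_def)
  then show "m \<in> ?R" using split by (metis (no_types, lifting) UN_iff image_eqI lessThan_iff)
next
  fix m assume "m \<in> ?R"
  then obtain q m' where q: "q < i" and m': "m' \<in> monomials_on A q"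
    and m: "m = m' + Poly_Mapping.single a (i - q)" by auto
  have "Poly_Mapping.keys m = insert a A"
    using m' q assms by (auto simp: m monomials_on_def in_keys_iff lookup_add lookup_single when_def split: if_splits)
  moreover have "mon_deg m = i"
    using m' q by (simp add: m mon_deg_add mon_deg_single monomials_on_def)
  ultimately show "m \<in> monomials_on (insert a A) i" by (simp add: monomials_on_def)
qed

text \<open>
  Each variable of the support has a positive exponent and so contributes a factor
  \<open>t + t\<^sup>2 + \<dots> = t/(1-t)\<close>.
\<close>

lemma card_monomials_on:
  assumes "finite A"
  shows "finite (monomials_on A i) \<and>
    int (card (monomials_on A i)) = fps_nth ((fps_X * geometric_series) ^ card A) i"
  using assms
proof (induction A arbitrary: i rule: finite_induct)
  case empty
  have "monomials_on {} i = (if i = 0 then {0} else {})"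
    by (auto simp: monomials_on_def mon_deg_def)
  then show ?case by simp
next
  case (insert a A)
  let ?f = "\<lambda>q m. m + Poly_Mapping.single a (i - q)"
  have fin: "finite (monomials_on A q)" for q using insert.IH by simp
  have at_a: "Poly_Mapping.lookup (?f q m) a = i - q" if "m \<in> monomials_on A q" for q m
  proof -
    have "a \<notin> Poly_Mapping.keys m" using that insert.hyps by (auto simp: monomials_on_def)
    then show ?thesis by (simp add: lookup_add in_keys_iff)
  qed
  have "card (monomials_on (insert a A) i) = (\<Sum>q<i. card (?f q ` monomials_on A q))"
    unfolding monomials_on_insert[OF insert.hyps(2)]
  proof (rule card_UN_disjoint)
    show "\<forall>q\<in>{..<i}. \<forall>q'\<in>{..<i}. q \<noteq> q' \<longrightarrow> ?f q ` monomials_on A q \<inter> ?f q' ` monomials_on A q' = {}"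
    proof (intro ballI impI equals0I)
      fix q q' m
      assume "q \<in> {..<i}" "q' \<in> {..<i}" "q \<noteq> q'"
        "m \<in> ?f q ` monomials_on A q \<inter> ?f q' ` monomials_on A q'"
      moreover from this have "i - q = i - q'" using at_a by (metis (no_types, lifting) IntE imageE)
      ultimately show False by auto
    qed
  qed (use fin in auto)
  also have "\<dots> = (\<Sum>q<i. card (monomials_on A q))"
    by (intro sum.cong refl card_image inj_onI) simp
  finally have "int (card (monomials_on (insert a A) i)) =
      (\<Sum>q<i. fps_nth ((fps_X * geometric_series) ^ card A) q)"
    using insert.IH by simp
  also have "\<dots> = fps_nth (fps_X * ((fps_X * geometric_series) ^ card A * geometric_series)) i"
  proof (cases i)
    case (Suc k)
    then show ?thesis
      by (simp add: fps_mult_nth[of "(fps_X * geometric_series) ^ card A"])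
        (simp add: geometric_series_def atLeast0AtMost flip: lessThan_Suc_atMost)
  qed simp
  also have "fps_X * ((fps_X * geometric_series) ^ card A * geometric_series) =
      (fps_X * geometric_series) ^ card (insert a A)"
    using insert.hyps by (simp add: mult_ac)
  finally show ?case using fin by (simp add: monomials_on_insert[OF insert.hyps(2)])
qed

definition supported_monomials :: "nat \<Rightarrow> (nat set \<Rightarrow> bool) \<Rightarrow> nat \<Rightarrow> (nat \<Rightarrow>\<^sub>0 nat) set" where
  "supported_monomials n P i =
     {m. Poly_Mapping.keys m \<subseteq> {1..n} \<and> P (Poly_Mapping.keys m) \<and> mon_deg m = i}"

lemma card_supported_monomials:
  "finite (supported_monomials n P i)" (is ?fin)
  "int (card (supported_monomials n P i)) =
     fps_nth (face_series n (\<lambda>j. int (card {B. B \<subseteq> {1..n} \<and> P B \<and> card B = j}))) i" (is ?card)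
proof -
  let ?S = "{B. B \<subseteq> {1..n} \<and> P B}"
  let ?g = "\<lambda>B. fps_nth ((fps_X * geometric_series) ^ card B) i"
  have S: "finite ?S" "\<And>B. B \<in> ?S \<Longrightarrow> finite B"
    by (auto intro: finite_subset[of _ "Pow {1..n}"] finite_subset)
  have eq: "supported_monomials n P i = (\<Union>B\<in>?S. monomials_on B i)"
    by (auto simp: supported_monomials_def monomials_on_def)
  show ?fin unfolding eq using S card_monomials_on by blast
  have "card (supported_monomials n P i) = (\<Sum>B\<in>?S. card (monomials_on B i))"
    unfolding eq using S card_monomials_on
    by (intro card_UN_disjoint) (auto simp: monomials_on_def)
  then have "int (card (supported_monomials n P i)) = (\<Sum>B\<in>?S. ?g B)"
    using S(2) card_monomials_on by simp
  also have "\<dots> = (\<Sum>j\<le>n. \<Sum>B\<in>{B\<in>?S. card B = j}. ?g B)"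
  proof (rule sum.group[symmetric])
    show "card ` ?S \<subseteq> {..n}" using card_mono[of "{1..n}"] by fastforce
  qed (use S in auto)
  also have "\<dots> = (\<Sum>j\<le>n. int (card {B. B \<subseteq> {1..n} \<and> P B \<and> card B = j}) *
      fps_nth ((fps_X * geometric_series) ^ j) i)"
    by (intro sum.cong refl) (simp add: conj_assoc)
  finally show ?card by (simp add: face_series_def fps_sum_nth)
qed

section \<open>Monomials in the cycle ideal\<close>

lemma poly_ring_a_inv:
  fixes p :: "'k::field mpol"
  assumes "p \<in> carrier (poly_ring n)"
  shows "\<ominus>\<^bsub>poly_ring n\<^esub> p = - p"
proof -
  interpret S: cring "poly_ring n :: 'k mpol ring" by (rule cring_poly_ring)
  show ?thesis
    by (rule S.minus_equality)
      (use assms carrier_poly_ring_uminus in \<open>auto simp: poly_ring_ops\<close>)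
qed

lemma keys_add_nat: "Poly_Mapping.keys (m + m') = Poly_Mapping.keys m \<union> Poly_Mapping.keys (m' :: nat \<Rightarrow>\<^sub>0 nat)"
  by (auto simp: in_keys_iff lookup_add)

lemma poly_mapping_eq_sum_singles:
  "p = (\<Sum>m\<in>Poly_Mapping.keys p. Poly_Mapping.single m (Poly_Mapping.lookup p m))"
  by (rule poly_mapping_eqI)
    (auto simp: lookup_sum lookup_single when_def in_keys_iff)

text \<open>
  Multiplication by a monomial can only enlarge the support. This makes the right-hand side of
  \<open>cycle_ideal_eq\<close> below an ideal, so that it contains the ideal generated by the edges.
\<close>

lemma ideal_of_upward_closed_supports:
  assumes up: "\<And>A B. P A \<Longrightarrow> A \<subseteq> B \<Longrightarrow> P B"
  shows "ideal {p \<in> carrier (poly_ring n). \<forall>m\<in>Poly_Mapping.keys p. P (Poly_Mapping.keys m)}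
    (poly_ring n :: 'k::field mpol ring)" (is "ideal ?I _")
proof -
  interpret S: cring "poly_ring n :: 'k mpol ring" by (rule cring_poly_ring)
  have mult: "a * x \<in> ?I" if "a \<in> ?I" "x \<in> carrier (poly_ring n)" for a x :: "'k mpol"
  proof -
    have "P (Poly_Mapping.keys m)" if "m \<in> Poly_Mapping.keys (a * x)" for m
    proof -
      from that keys_mult[of a x] obtain u v where "m = u + v" "u \<in> Poly_Mapping.keys a" by blast
      then show ?thesis using \<open>a \<in> ?I\<close> up[of "Poly_Mapping.keys u"] by (auto simp: keys_add_nat)
    qed
    then show ?thesis using that carrier_poly_ring_mult by blast
  qed
  show ?thesis
  proof (rule idealI[OF S.ring_axioms])
    show "subgroup ?I (add_monoid (poly_ring n))"
    proof (rule S.add.subgroupI)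
      show "?I \<noteq> {}" using carrier_poly_ring_0_1 by force
      show "\<ominus>\<^bsub>poly_ring n\<^esub> a \<in> ?I" if "a \<in> ?I" for a
        using that carrier_poly_ring_uminus by (auto simp: poly_ring_a_inv)
      show "a \<oplus>\<^bsub>poly_ring n\<^esub> b \<in> ?I" if "a \<in> ?I" "b \<in> ?I" for a b
        using that carrier_poly_ring_add Poly_Mapping.keys_add[of a b] by (auto simp: poly_ring_ops)
    qed auto
  qed (use mult in \<open>auto simp: poly_ring_ops mult.commute\<close>)
qed

lemma contains_cycle_edge_mono:
  "contains_cycle_edge n A \<Longrightarrow> A \<subseteq> B \<Longrightarrow> contains_cycle_edge n B"
  by (auto simp: contains_cycle_edge_def)

lemma var_pol_mult: "var_pol i * var_pol j =
    (Poly_Mapping.single (Poly_Mapping.single i 1 + Poly_Mapping.single j 1) 1 :: 'k::field mpol)"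
  by (simp add: var_pol_def mult_single)

lemma single_mem_ideal:
  fixes I :: "'k::field mpol set"
  assumes "ideal I (poly_ring n)" "var_pol i * var_pol j \<in> I" "i \<noteq> j"
    and "i \<in> Poly_Mapping.keys m" "j \<in> Poly_Mapping.keys m" "Poly_Mapping.keys m \<subseteq> {1..n}"
  shows "Poly_Mapping.single m c \<in> I"
proof -
  interpret I: ideal I "poly_ring n" by fact
  let ?e = "Poly_Mapping.single i 1 + Poly_Mapping.single j 1 :: nat \<Rightarrow>\<^sub>0 nat"
  have m: "m = (m - ?e) + ?e"
    using assms(3-5)
    by (intro poly_mapping_eqI) (auto simp: lookup_add lookup_minus lookup_single when_def in_keys_iff)
  have "Poly_Mapping.keys (m - ?e) \<subseteq> {1..n}"
    using assms(6) keys_add_nat[of "m - ?e" ?e] m by auto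
  then have "Poly_Mapping.single (m - ?e) c \<in> carrier (poly_ring n)"
    by (simp add: poly_ring_def)
  then have "Poly_Mapping.single (m - ?e) c * (var_pol i * var_pol j) \<in> I"
    using I.I_l_closed[OF assms(2)] by (simp add: poly_ring_ops)
  then show ?thesis
    using m by (simp add: var_pol_mult mult_single)
qed

text \<open>
  The generators are monomials, so membership can be tested on each monomial of a polynomial
  separately; and being squarefree, a generator divides a monomial iff the support contains its edge.
\<close>

lemma cycle_ideal_eq:
  assumes "n \<ge> 3"
  shows "(cycle_ideal n :: 'k::field mpol set) =
    {p \<in> carrier (poly_ring n). \<forall>m\<in>Poly_Mapping.keys p. contains_cycle_edge n (Poly_Mapping.keys m)}"
    (is "_ = ?M")
proof
  interpret S: cring "poly_ring n :: 'k mpol ring" by (rule cring_poly_ring)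
  interpret I: ideal "cycle_ideal n" "poly_ring n :: 'k mpol ring"
    by (rule ideal_cycle_ideal[OF assms])
  let ?G = "{var_pol i * var_pol (i + 1) | i. 1 \<le> i \<and> i < n} \<union> {var_pol n * var_pol 1} :: 'k mpol set"
  have G: "?G \<subseteq> carrier (poly_ring n)"
    using assms by (auto intro!: carrier_poly_ring_mult var_pol_in_carrier)
  have "?G \<subseteq> ?M"
  proof
    fix p assume p: "p \<in> ?G"
    then have "p \<in> carrier (poly_ring n)" using G by blast
    then show "p \<in> ?M"
      using p by (auto simp: var_pol_mult keys_add_nat contains_cycle_edge_def)
  qed
  then show "cycle_ideal n \<subseteq> ?M"
    unfolding cycle_ideal_def
    by (intro S.genideal_minimal ideal_of_upward_closed_supports) (rule contains_cycle_edge_mono)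
  have gen: "p \<in> cycle_ideal n" if "p \<in> ?G" for p
    unfolding cycle_ideal_def using S.genideal_self[OF G] that by blast
  show "?M \<subseteq> cycle_ideal n"
  proof
    fix p assume p: "p \<in> ?M"
    have mono: "Poly_Mapping.single m (Poly_Mapping.lookup p m) \<in> cycle_ideal n"
      if m: "m \<in> Poly_Mapping.keys p" for m
    proof -
      have sub: "Poly_Mapping.keys m \<subseteq> {1..n}" using p m by (auto simp: poly_ring_def)
      from p m consider i where "1 \<le> i" "i < n" "i \<in> Poly_Mapping.keys m" "i + 1 \<in> Poly_Mapping.keys m"
        | "n \<in> Poly_Mapping.keys m" "1 \<in> Poly_Mapping.keys m"
        by (auto simp: contains_cycle_edge_def)
      then show ?thesis
      proof cases
        case (1 i)
        then show ?thesis
          by (intro single_mem_ideal[OF I.ideal_axioms gen[of "var_pol i * var_pol (i + 1)"]] sub) auto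
      next
        case 2
        then show ?thesis using assms
          by (intro single_mem_ideal[OF I.ideal_axioms gen[of "var_pol n * var_pol 1"]] sub) auto
      qed
    qed
    have "(\<Sum>m\<in>F. Poly_Mapping.single m (Poly_Mapping.lookup p m)) \<in> cycle_ideal n"
      if "finite F" "F \<subseteq> Poly_Mapping.keys p" for F
      using that
    proof (induction F rule: finite_induct)
      case empty
      then show ?case using I.zero_closed by (simp add: poly_ring_ops)
    next
      case (insert m F)
      then show ?case using I.a_closed mono by (simp add: poly_ring_ops)
    qed
    then show "p \<in> cycle_ideal n"
      using poly_mapping_eq_sum_singles[of p] by (metis finite_keys order_refl)
  qed
qed

section \<open>Hilbert series of the ideal and of its quotient\<close>

text \<open>
  An isomorphism \<open>\<Phi>\<close> from the space of formal linear combinations of \<open>T\<close>: the images of the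
  elements of \<open>T\<close> are then a basis. This form serves both the ideal, where \<open>\<Phi>\<close> is the identity, and
  the quotient, where \<open>\<Phi>\<close> is the projection.
\<close>

lemma dim_eq_card_of_coordinates:
  fixes V :: "('k::field, 'v) module" and \<Phi> :: "('m \<Rightarrow>\<^sub>0 'k) \<Rightarrow> 'v"
  assumes V: "vectorspace class_ring V" and T: "finite T"
    and bij: "bij_betw \<Phi> {p. Poly_Mapping.keys p \<subseteq> T} (carrier V)"
    and zero: "\<Phi> 0 = \<zero>\<^bsub>V\<^esub>"
    and add: "\<And>p q. Poly_Mapping.keys p \<subseteq> T \<Longrightarrow> Poly_Mapping.keys q \<subseteq> T \<Longrightarrow> \<Phi> (p + q) = \<Phi> p \<oplus>\<^bsub>V\<^esub> \<Phi> q"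
    and scale: "\<And>m c. m \<in> T \<Longrightarrow> \<Phi> (Poly_Mapping.single m c) = c \<odot>\<^bsub>V\<^esub> \<Phi> (Poly_Mapping.single m 1)"
  shows "vectorspace.dim class_ring V = card T"
proof -
  interpret V: vectorspace class_ring V by (rule V)
  define b where "b m = \<Phi> (Poly_Mapping.single m 1)" for m
  have keys_sum: "Poly_Mapping.keys (\<Sum>m\<in>F. Poly_Mapping.single m (a m :: 'k)) \<subseteq> F"
    if "finite F" for F :: "'m set" and a
    using that by (auto simp: in_keys_iff lookup_sum lookup_single when_def split: if_splits)
  have lookup_sum_single: "Poly_Mapping.lookup (\<Sum>m\<in>T. Poly_Mapping.single m (a m :: 'k)) m = a m"
    if "m \<in> T" for a m
    using that T by (simp add: lookup_sum lookup_single when_def)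
  have inj: "inj_on \<Phi> {p. Poly_Mapping.keys p \<subseteq> T}" and img: "\<Phi> ` {p. Poly_Mapping.keys p \<subseteq> T} = carrier V"
    using bij by (auto simp: bij_betw_def)
  have carr: "\<Phi> p \<in> carrier V" if "Poly_Mapping.keys p \<subseteq> T" for p
    using img that by blast
  have b_carr: "b m \<in> carrier V" if "m \<in> T" for m
    using that by (auto simp: b_def intro: carr)
  have b_inj: "inj_on b T"
  proof (rule inj_onI)
    fix m m' assume m: "m \<in> T" "m' \<in> T" and "b m = b m'"
    then have "Poly_Mapping.single m (1 :: 'k) = Poly_Mapping.single m' 1"
      by (intro inj_onD[OF inj]) (auto simp: b_def)
    then have "Poly_Mapping.keys (Poly_Mapping.single m (1 :: 'k)) = Poly_Mapping.keys (Poly_Mapping.single m' (1 :: 'k))"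
      by simp
    then show "m = m'" by simp
  qed
  have smult_carr: "c \<odot>\<^bsub>V\<^esub> v \<in> carrier V" if "v \<in> carrier V" for c v
    using V.smult_closed[of c v] that by simp
  have finsum: "finsum V (\<lambda>m. a m \<odot>\<^bsub>V\<^esub> b m) F = \<Phi> (\<Sum>m\<in>F. Poly_Mapping.single m (a m))"
    if "finite F" "F \<subseteq> T" for a F
    using that
  proof (induction F rule: finite_induct)
    case empty
    then show ?case by (simp add: zero)
  next
    case (insert m F)
    have "finsum V (\<lambda>m. a m \<odot>\<^bsub>V\<^esub> b m) (insert m F) =
        a m \<odot>\<^bsub>V\<^esub> b m \<oplus>\<^bsub>V\<^esub> finsum V (\<lambda>m. a m \<odot>\<^bsub>V\<^esub> b m) F"
      using insert.hyps insert.prems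
      by (intro V.finsum_insert) (auto intro!: smult_carr b_carr)
    also have "a m \<odot>\<^bsub>V\<^esub> b m = \<Phi> (Poly_Mapping.single m (a m))"
      using insert.prems by (simp add: b_def scale[of m "a m"])
    also have "\<Phi> (Poly_Mapping.single m (a m)) \<oplus>\<^bsub>V\<^esub> finsum V (\<lambda>m. a m \<odot>\<^bsub>V\<^esub> b m) F =
        \<Phi> (Poly_Mapping.single m (a m) + (\<Sum>m\<in>F. Poly_Mapping.single m (a m)))"
      using insert keys_sum[of F a] by (subst add) auto
    finally show ?case using insert.hyps by simp
  qed
  have lincomb: "V.lincomb a (b ` T) = \<Phi> (\<Sum>m\<in>T. Poly_Mapping.single m (a (b m)))" for a
  proof -
    have "V.lincomb a (b ` T) = finsum V (\<lambda>m. a (b m) \<odot>\<^bsub>V\<^esub> b m) T"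
      unfolding V.lincomb_def using b_inj by (intro V.finsum_reindex) (auto intro!: smult_carr b_carr)
    then show ?thesis using finsum[OF T, of "\<lambda>m. a (b m)"] by simp
  qed
  have "V.basis (b ` T)"
  proof (subst V.basis_criterion)
    show "\<forall>v. v \<in> carrier V \<longrightarrow>
        (\<exists>!a. a \<in> b ` T \<rightarrow>\<^sub>E carrier (class_ring :: 'k ring) \<and> V.lincomb a (b ` T) = v)"
    proof (intro allI impI)
      fix v assume "v \<in> carrier V"
      then obtain p where p: "Poly_Mapping.keys p \<subseteq> T" "v = \<Phi> p" using img by auto
      show "\<exists>!a. a \<in> b ` T \<rightarrow>\<^sub>E carrier (class_ring :: 'k ring) \<and> V.lincomb a (b ` T) = v"
      proof (rule ex_ex1I)
        let ?a = "restrict (\<lambda>w. Poly_Mapping.lookup p (inv_into T b w)) (b ` T)"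
        have "(\<Sum>m\<in>T. Poly_Mapping.single m (?a (b m))) = (\<Sum>m\<in>T. Poly_Mapping.single m (Poly_Mapping.lookup p m))"
          using b_inj by (intro sum.cong) auto
        also have "\<dots> = p"
          using T p(1) by (intro poly_mapping_eqI)
            (auto simp: lookup_sum lookup_single when_def in_keys_iff)
        finally show "\<exists>a. a \<in> b ` T \<rightarrow>\<^sub>E carrier (class_ring :: 'k ring) \<and> V.lincomb a (b ` T) = v"
          using p(2) by (intro exI[of _ ?a]) (auto simp: lincomb)
      next
        fix a a'
        assume a: "a \<in> b ` T \<rightarrow>\<^sub>E carrier (class_ring :: 'k ring) \<and> V.lincomb a (b ` T) = v"
          and a': "a' \<in> b ` T \<rightarrow>\<^sub>E carrier (class_ring :: 'k ring) \<and> V.lincomb a' (b ` T) = v"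
        have eq: "(\<Sum>m\<in>T. Poly_Mapping.single m (a (b m))) = (\<Sum>m\<in>T. Poly_Mapping.single m (a' (b m)))"
          using a a' T keys_sum[of T] by (intro inj_onD[OF inj]) (auto simp: lincomb)
        have "a (b m) = a' (b m)" if "m \<in> T" for m
          using that lookup_sum_single[of m "\<lambda>m. a (b m)"] lookup_sum_single[of m "\<lambda>m. a' (b m)"] eq by simp
        then show "a = a'"
          by (intro PiE_ext[OF conjunct1[OF a] conjunct1[OF a']]) (elim imageE, simp)
      qed
    qed
  qed (use T b_carr in auto)
  then have "V.dim = card (b ` T)" using T by (intro V.dim_basis) auto
  then show ?thesis using b_inj by (simp add: card_image)
qed

lemma homog_part_eq:
  "homog_part n i = {p :: 'k::field mpol. \<forall>m\<in>Poly_Mapping.keys p. Poly_Mapping.keys m \<subseteq> {1..n} \<and> mon_deg m = i}"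
  by (auto simp: homog_part_def poly_ring_def)

lemma const_pol_mult_single: "const_pol c * Poly_Mapping.single m d = Poly_Mapping.single m (c * d)"
  by (simp add: const_pol_def mult_single)

lemma dim_ideal_part:
  assumes "n \<ge> 3"
  shows "vectorspace.dim class_ring
      (component_space (ideal_module (cycle_ideal n :: 'k::field mpol set)) (ideal_part n (cycle_ideal n)) i) =
    card (supported_monomials n (contains_cycle_edge n) i)"
proof (rule dim_eq_card_of_coordinates[where \<Phi> = "\<lambda>p. p"])
  have "ideal_part n (cycle_ideal n :: 'k mpol set) i =
      {p. Poly_Mapping.keys p \<subseteq> supported_monomials n (contains_cycle_edge n) i}"
    unfolding ideal_part_def cycle_ideal_eq[OF assms] homog_part_eq supported_monomials_def
    by (auto simp: poly_ring_def)
  then show "bij_betw (\<lambda>p. p) {p. Poly_Mapping.keys p \<subseteq> supported_monomials n (contains_cycle_edge n) i}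
      (carrier (component_space (ideal_module (cycle_ideal n :: 'k mpol set)) (ideal_part n (cycle_ideal n)) i))"
    by (simp add: component_space_def bij_betw_def)
  show "vectorspace class_ring
      (component_space (ideal_module (cycle_ideal n :: 'k mpol set)) (ideal_part n (cycle_ideal n)) i)"
    by (intro vectorspace_ideal_part ideal_cycle_ideal assms)
  show "finite (supported_monomials n (contains_cycle_edge n) i)"
    by (rule card_supported_monomials(1))
  show "Poly_Mapping.single m c =
      c \<odot>\<^bsub>component_space (ideal_module (cycle_ideal n)) (ideal_part n (cycle_ideal n)) i\<^esub>
        (Poly_Mapping.single m 1 :: 'k mpol)" for m c
    unfolding component_space_def ideal_module_def module.simps const_pol_mult_single by simp
qed (simp_all add: component_space_def ideal_module_def)

text \<open>
  The projection to the quotient is bijective on the span of the monomials without an edge: its kernel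
  is spanned by the other monomials.
\<close>

lemma dim_quot_part:
  assumes n: "n \<ge> 3"
  shows "vectorspace.dim class_ring
      (component_space (quot_module n (cycle_ideal n :: 'k::field mpol set)) (quot_part n (cycle_ideal n)) i) =
    card (supported_monomials n (\<lambda>B. \<not> contains_cycle_edge n B) i)"
proof -
  let ?J = "cycle_ideal n :: 'k mpol set"
  let ?R = "poly_ring n :: 'k mpol ring"
  let ?T = "supported_monomials n (\<lambda>B. \<not> contains_cycle_edge n B) i"
  let ?V = "component_space (quot_module n ?J) (quot_part n ?J) i"
  interpret S: cring ?R by (rule cring_poly_ring)
  interpret J: ideal ?J ?R by (rule ideal_cycle_ideal[OF n])
  interpret h: ring_hom_ring ?R "?R Quot ?J" "(+>\<^bsub>?R\<^esub>) ?J" by (rule J.rcos_ring_hom_ring)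
  have homog: "p \<in> homog_part n i" if "Poly_Mapping.keys p \<subseteq> ?T" for p :: "'k mpol"
    using that by (auto simp: homog_part_eq supported_monomials_def)
  then have carr: "p \<in> carrier ?R" if "Poly_Mapping.keys p \<subseteq> ?T" for p
    using that by (auto simp: homog_part_def)
  have same_coset: "?J +>\<^bsub>?R\<^esub> p = ?J +>\<^bsub>?R\<^esub> q \<longleftrightarrow> p - q \<in> ?J"
    if "p \<in> carrier ?R" "q \<in> carrier ?R" for p q
    using S.quotient_eq_iff_same_a_r_cos[OF J.ideal_axioms that] that
    by (simp add: a_minus_def poly_ring_a_inv poly_ring_ops)
  show ?thesis
  proof (rule dim_eq_card_of_coordinates[where \<Phi> = "\<lambda>p. ?J +>\<^bsub>?R\<^esub> p"])
    show "vectorspace class_ring ?V" by (rule vectorspace_quot_part[OF J.ideal_axioms])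
    show "bij_betw (\<lambda>p. ?J +>\<^bsub>?R\<^esub> p) {p. Poly_Mapping.keys p \<subseteq> ?T} (carrier ?V)"
      unfolding bij_betw_def
    proof
      show "inj_on (\<lambda>p. ?J +>\<^bsub>?R\<^esub> p) {p. Poly_Mapping.keys p \<subseteq> ?T}"
      proof (rule inj_onI)
        fix p q :: "'k mpol"
        assume pq: "p \<in> {p. Poly_Mapping.keys p \<subseteq> ?T}" "q \<in> {p. Poly_Mapping.keys p \<subseteq> ?T}"
          and "?J +>\<^bsub>?R\<^esub> p = ?J +>\<^bsub>?R\<^esub> q"
        then have "p - q \<in> ?J" using same_coset carr by simp
        moreover have "Poly_Mapping.keys (p - q) \<subseteq> ?T"
          using pq Poly_Mapping.keys_diff[of p q] by auto
        ultimately have "Poly_Mapping.keys (p - q) = {}"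
          unfolding cycle_ideal_eq[OF n] supported_monomials_def by blast
        then show "p = q" by simp
      qed
      have "quot_part n ?J i \<subseteq> (\<lambda>p. ?J +>\<^bsub>?R\<^esub> p) ` {p. Poly_Mapping.keys p \<subseteq> ?T}"
      proof
        fix v assume "v \<in> quot_part n ?J i"
        then obtain p where p: "p \<in> homog_part n i" "v = ?J +>\<^bsub>?R\<^esub> p"
          by (auto simp: quot_part_def)
        \<comment> \<open>Dropping the monomials of \<open>p\<close> that lie in the ideal does not change its class.\<close>
        define q where "q = (\<Sum>m\<in>Poly_Mapping.keys p \<inter> ?T. Poly_Mapping.single m (Poly_Mapping.lookup p m))"
        have lookup_q: "Poly_Mapping.lookup q m = (if m \<in> ?T then Poly_Mapping.lookup p m else 0)" for m
          by (auto simp: q_def lookup_sum lookup_single when_def in_keys_iff)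
        have q: "Poly_Mapping.keys q \<subseteq> ?T" by (auto simp: in_keys_iff lookup_q split: if_splits)
        have pc: "p \<in> carrier ?R" using p by (simp add: homog_part_def)
        have "p - q \<in> ?J"
        proof -
          have "m \<in> Poly_Mapping.keys p \<and> m \<notin> ?T" if "m \<in> Poly_Mapping.keys (p - q)" for m
            using that by (auto simp: in_keys_iff lookup_minus lookup_q split: if_splits)
          then show ?thesis using p(1)
            by (auto simp: cycle_ideal_eq[OF n] homog_part_eq supported_monomials_def poly_ring_def)
        qed
        then have "v = ?J +>\<^bsub>?R\<^esub> q" using same_coset[OF pc carr[OF q]] p(2) by simp
        then show "v \<in> (\<lambda>p. ?J +>\<^bsub>?R\<^esub> p) ` {p. Poly_Mapping.keys p \<subseteq> ?T}" using q by blast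
      qed
      then show "(\<lambda>p. ?J +>\<^bsub>?R\<^esub> p) ` {p. Poly_Mapping.keys p \<subseteq> ?T} = carrier ?V"
        using homog by (auto simp: component_space_def quot_part_def)
    qed
    show "?J +>\<^bsub>?R\<^esub> 0 = \<zero>\<^bsub>?V\<^esub>"
      using h.hom_zero by (simp add: component_space_def quot_module_def Let_def poly_ring_ops)
    show "?J +>\<^bsub>?R\<^esub> (p + q) = (?J +>\<^bsub>?R\<^esub> p) \<oplus>\<^bsub>?V\<^esub> (?J +>\<^bsub>?R\<^esub> q)"
      if "Poly_Mapping.keys p \<subseteq> ?T" "Poly_Mapping.keys q \<subseteq> ?T" for p q
      using h.hom_add[OF carr[OF that(1)] carr[OF that(2)]]
      by (simp add: component_space_def quot_module_def Let_def poly_ring_ops)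
    show "?J +>\<^bsub>?R\<^esub> Poly_Mapping.single m c = c \<odot>\<^bsub>?V\<^esub> (?J +>\<^bsub>?R\<^esub> Poly_Mapping.single m 1)"
      if "m \<in> ?T" for m c
    proof -
      have "Poly_Mapping.single m 1 \<in> carrier ?R" using that by (intro carr) simp
      then show ?thesis
        using h.hom_mult[OF const_pol_in_carrier[of c n], of "Poly_Mapping.single m 1"]
        by (simp add: component_space_def quot_module_def Let_def poly_ring_ops const_pol_mult_single)
    qed
  qed (rule card_supported_monomials)
qed

lemma hilbert_series_quotient:
  assumes "n \<ge> 3"
  shows "hilbert_series (quot_module n (cycle_ideal n :: 'k::field mpol set)) (quot_part n (cycle_ideal n)) =
    face_series n (\<lambda>j. int (card {B. B \<subseteq> {1..n} \<and> \<not> contains_cycle_edge n B \<and> card B = j}))"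
  by (rule fps_ext)
    (simp only: hilbert_series_def fps_nth_Abs_fps dim_quot_part[OF assms] card_supported_monomials(2))

lemma hilbert_series_ideal:
  assumes "n \<ge> 3"
  shows "hilbert_series (ideal_module (cycle_ideal n :: 'k::field mpol set)) (ideal_part n (cycle_ideal n)) =
    face_series n (\<lambda>j. int (card {B. B \<subseteq> {1..n} \<and> contains_cycle_edge n B \<and> card B = j}))"
  by (rule fps_ext)
    (simp only: hilbert_series_def fps_nth_Abs_fps dim_ideal_part[OF assms] card_supported_monomials(2))

section \<open>Hilbert depth\<close>

lemma alternating_sum_ibinom:
  "(\<Sum>j\<le>k. (- 1) ^ (k - j) * int ((d - j) choose (k - j)) * f j) =
     (\<Sum>j=0..k. (- 1) ^ (k - j) * ibinom (int d - int j) (int k - int j) * f j)"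
  unfolding atLeast0AtMost
proof (rule sum.cong)
  fix j assume "j \<in> {..k}"
  then have "int k - int j = int (k - j)" by auto
  then show "(- 1) ^ (k - j) * int ((d - j) choose (k - j)) * f j =
      (- 1) ^ (k - j) * ibinom (int d - int j) (int k - int j) * f j"
    by (simp only: ibinom_diff)
qed simp

theorem theorem3p15:
  fixes n :: nat and J :: "'k::field mpol set"
  assumes "n \<ge> 3" and "J = cycle_ideal n"
  shows
    "hdepth (quot_module n J) (quot_part n J) =
       Max {d::nat. d \<le> n \<and> (\<forall>k\<in>{1..d}.
         (\<Sum>j=0..k. (-1) ^ (k - j) * ibinom (int d - int j) (int k - int j) *
            (ibinom (int n - int j) (int j) + ibinom (int n - int j - 1) (int j - 1))) \<ge> 0)}
     \<and>
     hdepth (ideal_module J) (ideal_part n J) =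
       Max {d::nat. d \<le> n \<and> (\<forall>k\<in>{2..d}.
         (\<Sum>j=0..k. (-1) ^ (k - j) * ibinom (int d - int j) (int k - int j) *
            (ibinom (int n - int j) (int j) + ibinom (int n - int j - 1) (int j - 1)))
         \<le> ibinom (int n - int d + int k - 1) (int k))}"
proof
  define c where "c j = ibinom (int n - int j) (int j) + ibinom (int n - int j - 1) (int j - 1)" for j :: nat
  define s where "s d k = (\<Sum>j=0..k. (-1) ^ (k - j) * ibinom (int d - int j) (int k - int j) * c j)" for d k :: nat
  define ind where "ind j = int (card {B. B \<subseteq> {1..n} \<and> \<not> contains_cycle_edge n B \<and> card B = j})" for j
  define dep where "dep j = int (card {B. B \<subseteq> {1..n} \<and> contains_cycle_edge n B \<and> card B = j})" for j
  have ind: "ind j = c j" for j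
    unfolding ind_def c_def by (rule card_cycle_independent_sets[OF assms(1)])
  have dep: "dep j = int (n choose j) - c j" for j
    unfolding dep_def c_def by (rule card_cycle_dependent_sets[OF assms(1)])
  have c0: "c 0 = 1" by (simp add: c_def ibinom_def)
  have ind_sum: "(\<Sum>j\<le>k. (- 1) ^ (k - j) * int ((d - j) choose (k - j)) * ind j) = s d k" for d k
    by (simp only: alternating_sum_ibinom s_def ind)
  have s0: "s d 0 = 1" for d by (simp add: s_def c0 ibinom_def)
  have "{r. \<forall>i. 0 \<le> fps_nth ((1 - fps_X) ^ r * hilbert_series (quot_module n J) (quot_part n J)) i} =
      {d. d \<le> n \<and> (\<forall>k\<le>d. 0 \<le> s d k)}"
    unfolding assms(2) hilbert_series_quotient[OF assms(1)] ind_def[symmetric] ind_sum[symmetric]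
    by (rule nonneg_exponents[of _ 0]) (use ind[of 0] c0 in \<open>auto simp: ind_def\<close>)
  also have "\<dots> = {d. d \<le> n \<and> (\<forall>k\<in>{1..d}. s d k \<ge> 0)}"
  proof -
    have "(\<forall>k\<le>d. 0 \<le> s d k) \<longleftrightarrow> (\<forall>k\<in>{1..d}. s d k \<ge> 0)" for d
    proof
      assume pos: "\<forall>k\<in>{1..d}. s d k \<ge> 0"
      show "\<forall>k\<le>d. 0 \<le> s d k"
      proof (intro allI impI)
        fix k assume "k \<le> d"
        then show "0 \<le> s d k" using pos s0[of d] by (cases "k = 0") auto
      qed
    qed auto
    then show ?thesis by simp
  qed
  finally show "hdepth (quot_module n J) (quot_part n J) =
       Max {d::nat. d \<le> n \<and> (\<forall>k\<in>{1..d}.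
         (\<Sum>j=0..k. (-1) ^ (k - j) * ibinom (int d - int j) (int k - int j) *
            (ibinom (int n - int j) (int j) + ibinom (int n - int j - 1) (int j - 1))) \<ge> 0)}"
    by (simp only: hdepth_def s_def c_def)

  have dep_sum: "(\<Sum>j\<le>k. (- 1) ^ (k - j) * int ((d - j) choose (k - j)) * dep j) =
      ibinom (int n - int d + int k - 1) (int k) - s d k" if "k \<le> d" "d \<le> n" for d k
  proof -
    have "(\<Sum>j\<le>k. (- 1) ^ (k - j) * int ((d - j) choose (k - j)) * dep j) =
        (\<Sum>j\<le>k. (- 1) ^ (k - j) * int ((d - j) choose (k - j)) * int (n choose j)) -
        (\<Sum>j\<le>k. (- 1) ^ (k - j) * int ((d - j) choose (k - j)) * ind j)"
      by (simp add: dep ind right_diff_distrib sum_subtractf)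
    then show ?thesis by (simp only: alternating_sum_full[OF that] ind_sum)
  qed
  have dep_low: "dep j = 0" if "j \<le> 1" for j
  proof -
    have "{B. B \<subseteq> {1..n} \<and> contains_cycle_edge n B \<and> card B = j} = {}"
      using no_cycle_edge_if_card_le_1[of n] assms(1) that finite_subset[of _ "{1..n}"] by fastforce
    then show ?thesis by (simp add: dep_def)
  qed
  \<comment> \<open>This makes the Hilbert series of the ideal nonzero, so that its set of exponents is finite.\<close>
  have dep2: "dep 2 \<noteq> 0"
  proof -
    have "{1, 2} \<in> {B. B \<subseteq> {1..n} \<and> contains_cycle_edge n B \<and> card B = 2}"
      using assms(1) by (auto simp: contains_cycle_edge_def)
    then have "{B. B \<subseteq> {1..n} \<and> contains_cycle_edge n B \<and> card B = 2} \<noteq> {}" by blast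
    then show ?thesis by (simp add: dep_def card_eq_0_iff)
  qed
  have "{r. \<forall>i. 0 \<le> fps_nth ((1 - fps_X) ^ r * hilbert_series (ideal_module J) (ideal_part n J)) i} =
      {d. d \<le> n \<and> (\<forall>k\<le>d. 0 \<le> (\<Sum>j\<le>k. (- 1) ^ (k - j) * int ((d - j) choose (k - j)) * dep j))}"
    unfolding assms(2) hilbert_series_ideal[OF assms(1)] dep_def[symmetric]
    by (rule nonneg_exponents[of _ 2]) (use assms(1) dep2 in \<open>auto simp: dep_def\<close>)
  also have "\<dots> = {d. d \<le> n \<and> (\<forall>k\<in>{2..d}. s d k \<le> ibinom (int n - int d + int k - 1) (int k))}"
  proof -
    have "(\<forall>k\<le>d. 0 \<le> (\<Sum>j\<le>k. (- 1) ^ (k - j) * int ((d - j) choose (k - j)) * dep j)) \<longleftrightarrow>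
        (\<forall>k\<in>{2..d}. s d k \<le> ibinom (int n - int d + int k - 1) (int k))" (is "?A \<longleftrightarrow> ?B")
      if "d \<le> n" for d
    proof
      assume ?A
      then show ?B using dep_sum[OF _ that] by auto
    next
      assume B: ?B
      show ?A
      proof (intro allI impI)
        fix k assume "k \<le> d"
        show "0 \<le> (\<Sum>j\<le>k. (- 1) ^ (k - j) * int ((d - j) choose (k - j)) * dep j)"
        proof (cases "k \<le> 1")
          case True
          then show ?thesis using dep_low by (intro sum_nonneg) auto
        next
          case False
          then show ?thesis using B \<open>k \<le> d\<close> dep_sum[OF \<open>k \<le> d\<close> that] by auto
        qed
      qed
    qed
    then show ?thesis by auto
  qed
  finally show "hdepth (ideal_module J) (ideal_part n J) =
       Max {d::nat. d \<le> n \<and> (\<forall>k\<in>{2..d}.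
         (\<Sum>j=0..k. (-1) ^ (k - j) * ibinom (int d - int j) (int k - int j) *
            (ibinom (int n - int j) (int j) + ibinom (int n - int j - 1) (int j - 1)))
         \<le> ibinom (int n - int d + int k - 1) (int k))}"
    by (simp only: hdepth_def s_def c_def)
qed

end
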